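(* Let $p>1$, $\beta,b,M>0$, and let $$\bar R:=\frac{\beta(p-1)^{\frac{p-1}{p}}}{p\,b^{\frac1p}\,M^{\frac{p-1}{p}}}.$$ Let $i\in\{1,\dots,N-1\}$. There exists a function $u=u(r)\in LSC([0,\bar R])\cap C^2((0,\bar R))$ such that $x\mapsto u(|x|)$ is a (radial) solution of $$\beta\lambda_i(D^2u)+b|Du|^p=-M\ \text{ in }B_{\bar R}\setminus\{0\},\qquad u=0\ \text{ on }\partial B_{\bar R}.$$ Moreover, if $p\in(1,2]$ then $\lim_{r\to0^+}u(r)=+\infty$, while if $p>2$ the function $u$ is bounded.
   Context: For a real symmetric $N\times N$ matrix $X$, $\lambda_1(X)\le\dots\le\lambda_N(X)$ denote its eigenvalues in nondecreasing order. $B_{\bar R}\subset\mathbb{R}^N$ is the open ball of radius $\bar R$ centered at the origin. $LSC([0,\bar R])$ denotes lower semicontinuous functions on $[0,\bar R]$, where the value $+\infty$ is allowed at $r=0$. *)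

theory Defs
  imports "HOL-Analysis.Analysis"
begin

definition grad :: "(real^'n \<Rightarrow> real) \<Rightarrow> real^'n \<Rightarrow> real^'n" where
  "grad f x = (THE D. GDERIV f x :> D)"

definition hessian :: "(real^'n \<Rightarrow> real) \<Rightarrow> real^'n \<Rightarrow> real^'n^'n" where
  "hessian f x = jacobian (grad f) (at x)"

text \<open>
  \<open>grad\<close> and \<open>hessian\<close> are total functions with unspecified values where the derivatives do not
  exist, so a pointwise equation involving them must be paired with the following predicate.
\<close>
definition twice_differentiable_at :: "(real^'n \<Rightarrow> real) \<Rightarrow> real^'n \<Rightarrow> bool" where
  "twice_differentiable_at f x \<longleftrightarrow>
     (\<forall>\<^sub>F y in nhds x. f differentiable (at y)) \<and> grad f differentiable (at x)"

definition eigenspace :: "real^'n^'n \<Rightarrow> real \<Rightarrow> (real^'n) set" where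
  "eigenspace X c = {v. X *v v = c *\<^sub>R v}"

text \<open>
  The eigenvalues in nondecreasing order, each repeated as often as the dimension of its
  eigenspace. For symmetric \<open>X\<close>, the only case in which \<open>eigenval\<close> is meant to be used, this
  is also the algebraic multiplicity and the list has length \<open>CARD('n)\<close>.
\<close>
definition eigenvalues_sorted :: "real^'n^'n \<Rightarrow> real list" where
  "eigenvalues_sorted X =
     concat (map (\<lambda>c. replicate (dim (eigenspace X c)) c)
       (sorted_list_of_set {c. \<exists>v. v \<noteq> 0 \<and> v \<in> eigenspace X c}))"

text \<open>The index starts at 1: \<open>eigenval 1 X\<close> is the smallest eigenvalue.\<close>
definition eigenval :: "nat \<Rightarrow> real^'n^'n \<Rightarrow> real" where
  "eigenval i X = eigenvalues_sorted X ! (i - 1)"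

definition lsc_on :: "'a::topological_space set \<Rightarrow> ('a \<Rightarrow> ereal) \<Rightarrow> bool" where
  "lsc_on S f \<longleftrightarrow> (\<forall>x\<in>S. f x \<le> Liminf (at x within S) f)"

text \<open>The set \<open>LSC([0,R])\<close>: real values, except that \<open>+\<infinity>\<close> is allowed at \<open>0\<close>.\<close>
definition LSC_radial :: "real \<Rightarrow> (real \<Rightarrow> ereal) set" where
  "LSC_radial R = {u. lsc_on {0..R} u \<and> u 0 \<noteq> -\<infinity> \<and> (\<forall>r\<in>{0<..R}. \<bar>u r\<bar> \<noteq> \<infinity>)}"

text \<open>Intended for open \<open>S\<close>.\<close>
definition C2_on :: "real set \<Rightarrow> (real \<Rightarrow> real) \<Rightarrow> bool" where
  "C2_on S g \<longleftrightarrow>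
     (\<exists>g' g''. (\<forall>x\<in>S. (g has_real_derivative g' x) (at x) \<and> (g' has_real_derivative g'' x) (at x))
        \<and> continuous_on S g'')"

definition crit_radius :: "real \<Rightarrow> real \<Rightarrow> real \<Rightarrow> real \<Rightarrow> real" where
  "crit_radius p \<beta> b M =
     \<beta> * (p - 1) powr ((p - 1) / p) / (p * b powr (1 / p) * M powr ((p - 1) / p))"

text \<open>
  Classical solution \<open>w\<close> of \<open>\<beta> \<lambda>\<^sub>i(D\<^sup>2w) + b |Dw|\<^sup>p = -M\<close> in \<open>\<Omega>\<close>.
\<close>
definition solves_eigen_eq ::
  "nat \<Rightarrow> real \<Rightarrow> real \<Rightarrow> real \<Rightarrow> real \<Rightarrow> (real^'n) set \<Rightarrow> (real^'n \<Rightarrow> real) \<Rightarrow> bool" where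
  "solves_eigen_eq i p \<beta> b M \<Omega> w \<longleftrightarrow>
     (\<forall>x\<in>\<Omega>. twice_differentiable_at w x \<and>
        \<beta> * eigenval i (hessian w x) + b * norm (grad w x) powr p = - M)"

end

theory Submission
  imports Defs
begin

text \<open>
  If a radial \<open>u\<close> has \<open>u' = - v < 0\<close> and \<open>u'' > u' / r\<close>, then the Hessian
  is a multiple of the identity plus a positive rank-one matrix, so its lowest \<open>N - 1\<close>
  eigenvalues all equal \<open>- v / r\<close> and the equation becomes \<open>r = \<beta> v / (M + b v\<^sup>p)\<close>.
  The right-hand side, as a function of \<open>v\<close>, increases up to its maximum \<open>crit_radius\<close> and
  then decreases to \<open>0\<close>. Solving on the decreasing branch gives \<open>v\<close> with \<open>v' < 0\<close>, and
  \<open>u(r)\<close> is the integral of \<open>v\<close> over \<open>[r, R]\<close>. Near \<open>0\<close> this \<open>v\<close> is comparable to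
  \<open>r\<close> to the power \<open>- 1 / (p - 1)\<close>, which is integrable exactly when \<open>p > 2\<close>.
\<close>

section \<open>Spectrum of a rank-one perturbation of a multiple of the identity\<close>

text \<open>The hyperplane orthogonal to \<open>x\<close> is the eigenspace of \<open>c\<close>, and
  \<open>x\<close> is an eigenvector for the larger value \<open>c + k * (x \<bullet> x)\<close>. So
  the sorted list starts with \<open>CARD('n) - 1\<close> copies of \<open>c\<close>, and the index
  \<open>i - 1\<close> falls among them.\<close>

lemma eigenval_rank_one_perturbation:
  fixes A :: "real^'n^'n" and x :: "real^'n"
  assumes A: "\<And>h. A *v h = c *\<^sub>R h + (k * (x \<bullet> h)) *\<^sub>R x"
    and x: "x \<noteq> 0" and k: "k > 0" and i: "1 \<le> i" "i \<le> CARD('n) - 1"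
  shows "eigenval i A = c"
proof -
  define d where "d = c + k * (x \<bullet> x)"
  have xx: "x \<bullet> x > 0" using x by simp
  have cd: "c < d" using k xx by (simp add: d_def)
  have E: "eigenspace A c = {h. x \<bullet> h = 0}"
    using x k by (auto simp: eigenspace_def A)
  have dimE: "dim (eigenspace A c) = CARD('n) - 1"
    unfolding E using dim_hyperplane[OF x] by simp
  \<comment> \<open>The bounds on \<open>i\<close> force \<open>CARD('n) \<ge> 2\<close>, so the
    hyperplane is not trivial.\<close>
  have "\<exists>v. v \<noteq> 0 \<and> v \<in> eigenspace A c"
    using dimE i dim_eq_0[of "eigenspace A c"] by fastforce
  moreover have "x \<in> eigenspace A d"
    by (simp add: eigenspace_def A d_def scaleR_add_left)
  moreover have "e = c \<or> e = d" if "v \<noteq> 0" "v \<in> eigenspace A e" for e v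
  proof (rule disjCI)
    assume "e \<noteq> d"
    have ev: "c *\<^sub>R v + (k * (x \<bullet> v)) *\<^sub>R x = e *\<^sub>R v"
      using that by (simp add: eigenspace_def A)
    \<comment> \<open>Pairing with \<open>x\<close> shows that an eigenvector for a value other than
      \<open>d\<close> is orthogonal to \<open>x\<close>.\<close>
    have "x \<bullet> (c *\<^sub>R v + (k * (x \<bullet> v)) *\<^sub>R x) = x \<bullet> (e *\<^sub>R v)"
      by (simp only: ev)
    then have "(d - e) * (x \<bullet> v) = 0"
      by (simp add: inner_add_right d_def algebra_simps)
    with \<open>e \<noteq> d\<close> have "x \<bullet> v = 0" by simp
    with ev that show "e = c" by simp
  qed
  ultimately have "{e. \<exists>v. v \<noteq> 0 \<and> v \<in> eigenspace A e} = {c, d}"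
    using x by blast
  moreover have "sorted_list_of_set {c, d} = [c, d]"
    using cd sorted_list_of_set_sort_remdups[of "[c, d]"] by simp
  ultimately show ?thesis
    using i dimE by (auto simp: eigenval_def eigenvalues_sorted_def nth_append)
qed

section \<open>Gradient and Hessian of radial functions\<close>

lemma gderiv_unique:
  assumes "GDERIV f x :> D" "GDERIV f x :> E"
  shows "D = E"
proof -
  have "(\<lambda>h. h \<bullet> D) = (\<lambda>h. h \<bullet> E)"
    using assms unfolding gderiv_def by (rule has_derivative_unique)
  then show ?thesis
    by (metis inner_commute vector_eq_ldot)
qed

lemma grad_eqI:
  assumes "GDERIV f x :> D"
  shows "grad f x = D"
  unfolding grad_def using assms gderiv_unique by blast

lemma gderiv_radial:
  fixes x :: "'a::real_inner"
  assumes "(f has_real_derivative d) (at (norm x))" "x \<noteq> 0"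
  shows "GDERIV (\<lambda>x. f (norm x)) x :> (d / norm x) *\<^sub>R x"
  using GDERIV_DERIV_compose[OF GDERIV_norm[OF assms(2)] assms(1)]
  by (simp add: sgn_div_norm divide_inverse)

lemma has_derivative_radial_scaleR:
  fixes x :: "'a::real_inner"
  assumes "(q has_real_derivative d) (at (norm x))" "x \<noteq> 0"
  shows "((\<lambda>y. q (norm y) *\<^sub>R y) has_derivative
     (\<lambda>h. q (norm x) *\<^sub>R h + (d / norm x * (x \<bullet> h)) *\<^sub>R x)) (at x)"
proof -
  have "((\<lambda>y. q (norm y)) has_derivative (\<lambda>h. h \<bullet> ((d / norm x) *\<^sub>R x))) (at x)"
    using gderiv_radial[OF assms] by (simp add: gderiv_def)
  from has_derivative_scaleR[OF this has_derivative_ident] show ?thesis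
    by (simp add: inner_commute)
qed

text \<open>Near \<open>x\<close> the gradient is the field \<open>q (norm y) *\<^sub>R y\<close>
  with \<open>q r = f' r / r\<close>, and the product rule differentiates it. Nothing is asked of
  \<open>w\<close> at the origin, where the solution may be infinite.\<close>

lemma grad_radial_has_derivative:
  fixes x :: "real^'n"
  assumes f: "\<And>r. r \<in> {0<..<R} \<Longrightarrow> (f has_real_derivative f' r) (at r)"
    and f': "(f' has_real_derivative d) (at (norm x))"
    and x: "x \<noteq> 0" "norm x < R"
    and w: "\<And>y. y \<noteq> 0 \<Longrightarrow> w y = f (norm y)"
  shows "\<forall>\<^sub>F y in nhds x. w differentiable (at y)"
    and "grad w x = (f' (norm x) / norm x) *\<^sub>R x"
    and "(grad w has_derivative (\<lambda>h. (f' (norm x) / norm x) *\<^sub>R h +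
           ((d - f' (norm x) / norm x) / (norm x)\<^sup>2 * (x \<bullet> h)) *\<^sub>R x)) (at x)"
proof -
  define S where "S = ball (0 :: real^'n) R - {0}"
  have S: "open S" "x \<in> S"
    using x by (auto simp: S_def)
  have gd: "GDERIV w y :> (f' (norm y) / norm y) *\<^sub>R y" if "y \<in> S" for y
  proof -
    have y: "y \<noteq> 0" "norm y < R"
      using that by (auto simp: S_def)
    have "GDERIV (\<lambda>x. f (norm x)) y :> (f' (norm y) / norm y) *\<^sub>R y"
      using y by (intro gderiv_radial f) auto
    then show ?thesis
      unfolding gderiv_def
      by (rule has_derivative_transform_within_open[where s = "- {0}"]) (use y w in auto)
  qed
  have "\<forall>\<^sub>F y in nhds x. y \<in> S"
    using S by (rule eventually_nhds_in_open)
  then show "\<forall>\<^sub>F y in nhds x. w differentiable (at y)"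
    by (rule eventually_mono) (use gd in \<open>auto simp: gderiv_def differentiable_def\<close>)
  show "grad w x = (f' (norm x) / norm x) *\<^sub>R x"
    using gd S grad_eqI by blast
  let ?r = "norm x"
  have "((\<lambda>r. f' r / r) has_real_derivative (d * ?r - f' ?r * 1) / (?r * ?r)) (at ?r)"
    using x by (intro DERIV_divide f' DERIV_ident) auto
  from has_derivative_radial_scaleR[OF this x(1)]
  have "((\<lambda>y. (f' (norm y) / norm y) *\<^sub>R y) has_derivative
     (\<lambda>h. (f' ?r / ?r) *\<^sub>R h + ((d * ?r - f' ?r * 1) / (?r * ?r) / ?r * (x \<bullet> h)) *\<^sub>R x)) (at x)" .
  \<comment> \<open>In this form the sign of the rank-one coefficient is that of
    \<open>d - f' ?r / ?r\<close>.\<close>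
  also have "(d * ?r - f' ?r * 1) / (?r * ?r) / ?r = (d - f' ?r / ?r) / ?r\<^sup>2"
    using x by (simp add: field_simps power2_eq_square)
  finally show "(grad w has_derivative (\<lambda>h. (f' (norm x) / norm x) *\<^sub>R h +
           ((d - f' (norm x) / norm x) / (norm x)\<^sup>2 * (x \<bullet> h)) *\<^sub>R x)) (at x)"
    by (rule has_derivative_transform_within_open[OF _ S]) (use gd grad_eqI in metis)
qed

text \<open>The radial direction carries the eigenvalue \<open>d\<close>, the tangential ones
  \<open>f' (norm x) / norm x\<close>. The assumption that \<open>d\<close> is the larger puts the
  tangential value in the first \<open>CARD('n) - 1\<close> places.\<close>

lemma eigenval_hessian_radial:
  fixes x :: "real^'n"
  assumes f: "\<And>r. r \<in> {0<..<R} \<Longrightarrow> (f has_real_derivative f' r) (at r)"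
    and f': "(f' has_real_derivative d) (at (norm x))"
    and x: "x \<noteq> 0" "norm x < R"
    and w: "\<And>y. y \<noteq> 0 \<Longrightarrow> w y = f (norm y)"
    and d: "d > f' (norm x) / norm x"
    and i: "1 \<le> i" "i \<le> CARD('n) - 1"
  shows "twice_differentiable_at w x" and "eigenval i (hessian w x) = f' (norm x) / norm x"
proof -
  note D = grad_radial_has_derivative[OF f f' x w]
  then have diff: "grad w differentiable (at x)"
    by (auto simp: differentiable_def)
  then show "twice_differentiable_at w x"
    using D(1) by (simp add: twice_differentiable_at_def)
  have "(grad w has_derivative (\<lambda>h. hessian w x *v h)) (at x)"
    unfolding hessian_def using diff jacobian_works by blast
  from has_derivative_unique[OF this D(3)]
  have "hessian w x *v h = (f' (norm x) / norm x) *\<^sub>R h +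
      ((d - f' (norm x) / norm x) / (norm x)\<^sup>2 * (x \<bullet> h)) *\<^sub>R x" for h
    by metis
  then show "eigenval i (hessian w x) = f' (norm x) / norm x"
    by (rule eigenval_rank_one_perturbation) (use x d i in auto)
qed

section \<open>The critical radius and the decreasing branch\<close>

text \<open>Here \<open>w\<close> is the critical point of
  \<open>\<beta> * t / (M + b * t powr p)\<close>: the second claim says that the derivative
  vanishes there, the third that the critical value is \<open>crit_radius\<close>.\<close>

lemma crit_radius_conv:
  assumes p: "p > 1" and pos: "\<beta> > 0" "b > 0" "M > 0"
  defines "w \<equiv> (M / (b * (p - 1))) powr (1 / p)"
  shows "w > 0" and "(p - 1) * b * w powr p = M"
    and "crit_radius p \<beta> b M = \<beta> * w / (M + b * w powr p)"
proof -
  show w: "w > 0" using p pos by (simp add: w_def)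
  have wp: "w powr p = M / (b * (p - 1))"
    using p pos by (simp add: w_def powr_powr)
  then show M: "(p - 1) * b * w powr p = M"
    using p pos by simp
  have e: "(p - 1) / p = 1 - 1 / p" 
    using p by (simp add: field_simps)
  have "crit_radius p \<beta> b M
      = \<beta> * ((p - 1) / (p - 1) powr (1 / p)) / (p * b powr (1 / p) * (M / M powr (1 / p)))"
    unfolding crit_radius_def e using p pos by (simp add: powr_diff)
  also have "\<dots> = \<beta> * (p - 1) * (M powr (1 / p) / (b powr (1 / p) * (p - 1) powr (1 / p))) / (p * M)"
    using p pos by (simp add: field_simps)
  also have "M powr (1 / p) / (b powr (1 / p) * (p - 1) powr (1 / p)) = w"
    unfolding w_def using p pos by (simp add: powr_divide powr_mult)
  also have "p * M = (p - 1) * (M + b * w powr p)"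
    using M by (simp add: algebra_simps)
  finally show "crit_radius p \<beta> b M = \<beta> * w / (M + b * w powr p)"
    using p by simp
qed

text \<open>The function \<open>g\<close> decreases strictly on \<open>{w..}\<close> from
  \<open>R\<close> towards \<open>0\<close>, and \<open>v\<close> is its inverse. The bound on
  \<open>M\<close> records \<open>v r \<ge> w\<close>. Since \<open>g'\<close> vanishes at
  \<open>w = v R\<close>, differentiability of \<open>v\<close> is claimed only below
  \<open>R\<close>.\<close>

lemma upper_branch_exists:
  fixes p \<beta> b M :: real
  assumes p: "p > 1" and pos: "\<beta> > 0" "b > 0" "M > 0"
    and R: "R = crit_radius p \<beta> b M"
  obtains v v' :: "real \<Rightarrow> real" where
    "\<And>r. r \<in> {0<..R} \<Longrightarrow> v r > 0 \<and> M \<le> (p - 1) * b * v r powr p \<and> \<beta> * v r = r * (M + b * v r powr p)"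
    "continuous_on {0<..R} v"
    "\<And>r. r \<in> {0<..<R} \<Longrightarrow> (v has_real_derivative v' r) (at r) \<and> v' r < 0"
    "continuous_on {0<..<R} v'"
proof -
  define w where "w = (M / (b * (p - 1))) powr (1 / p)"
  define g where "g = (\<lambda>t. \<beta> * t / (M + b * t powr p))"
  define g' where "g' = (\<lambda>t. \<beta> * (M - (p - 1) * b * t powr p) / (M + b * t powr p)\<^sup>2)"
  note w = crit_radius_conv[OF p pos, folded w_def]
  have gw: "g w = R" using w(3) R by (simp add: g_def)
  have den: "M + b * t powr p > 0" for t
    using pos by (simp add: add_pos_nonneg)
  have dg: "(g has_real_derivative g' t) (at t)" if "t > 0" for t
  proof -
    have tp: "t * t powr (p - 1) = t powr p"
      using that by (simp add: powr_diff)
    have "(g has_real_derivative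
        (\<beta> * (M + b * t powr p) - \<beta> * t * (b * (p * t powr (p - 1)))) / (M + b * t powr p)\<^sup>2) (at t)"
      unfolding g_def using that den[of t]
      by (auto intro!: derivative_eq_intros simp: power2_eq_square)
    also have "\<beta> * t * (b * (p * t powr (p - 1))) = \<beta> * b * p * t powr p"
      by (simp flip: tp)
    finally show ?thesis
      by (simp add: g'_def algebra_simps)
  qed
  have mono_w: "w powr p < t powr p" if "w < t" for t
    using that w(1) p by (intro powr_less_mono2) auto
  have g'_neg: "g' t < 0" if "w < t" for t
  proof -
    have "(p - 1) * b * w powr p < (p - 1) * b * t powr p"
      using mono_w[OF that] p pos by (intro mult_strict_left_mono) auto
    then show ?thesis
      using w(2) pos den[of t] by (simp add: g'_def divide_neg_pos mult_pos_neg)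
  qed
  have cont_g: "continuous_on S g" if "S \<subseteq> {w..}" for S
  proof (rule DERIV_continuous_on)
    fix t assume "t \<in> S"
    then have "t > 0" using that w(1) by auto
    then show "(g has_real_derivative g' t) (at t within S)"
      by (rule has_field_derivative_at_within[OF dg])
  qed
  have anti: "g t < g s" if "w \<le> s" "s < t" for s t
  proof (rule DERIV_neg_imp_decreasing_open[OF \<open>s < t\<close>])
    show "continuous_on {s..t} g"
      using that by (intro cont_g) auto
  next
    fix x assume "s < x"
    then show "\<exists>y. DERIV g x :> y \<and> y < 0"
      using that w(1) g'_neg dg by (intro exI[of _ "g' x"]) auto
  qed
  have inj: "inj_on g {w..}"
    by (rule linorder_inj_onI') (use anti in force)
  define v where "v = the_inv_into {w..} g"
  have v_g: "v (g t) = t" if "w \<le> t" for t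
    unfolding v_def using that inj by (simp add: the_inv_into_f_f)
  \<comment> \<open>Dropping \<open>M\<close> from the denominator bounds \<open>g t\<close> by a
    multiple of \<open>t powr (1 - p)\<close>. With the intermediate value theorem this makes every
    \<open>r\<close> in \<open>{0<..R}\<close> a value of \<open>g\<close>.\<close>
  have "(g \<longlongrightarrow> 0) at_top"
  proof -
    have "((\<lambda>t. \<beta> / b * t powr (1 - p)) \<longlongrightarrow> \<beta> / b * 0) at_top"
      using p by (intro tendsto_mult_left tendsto_neg_powr filterlim_ident) auto
    moreover have "\<forall>\<^sub>F t in at_top. g t \<le> \<beta> / b * t powr (1 - p)"
      using eventually_gt_at_top[of 0]
    proof eventually_elim
      case (elim t)
      have "g t \<le> \<beta> * t / (b * t powr p)"
        unfolding g_def using elim pos den[of t] by (intro divide_left_mono) auto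
      then show ?case using elim by (simp add: powr_diff)
    qed
    moreover have "\<forall>\<^sub>F t in at_top. 0 \<le> g t"
      using eventually_gt_at_top[of 0]
      by eventually_elim (use pos den in \<open>auto simp: g_def less_imp_le\<close>)
    ultimately show ?thesis
      by (auto intro: tendsto_sandwich[of "\<lambda>_. 0"])
  qed
  then have small: "\<exists>T\<ge>w. g T < r" if "r > 0" for r
    using order_tendstoD(2)[OF _ that] eventually_ge_at_top[of w] eventually_happens'[OF trivial_limit_at_top_linorder]
    by (metis (mono_tags, lifting) eventually_conj)
  have image: "\<exists>t\<in>{w..T}. g t = r" if "g T \<le> r" "r \<le> R" "w \<le> T" for r T
    using IVT2'[of g T r w] that gw cont_g[of "{w..T}"] by auto
  have v: "w \<le> v r \<and> g (v r) = r" if r: "r \<in> {0<..R}" for r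
  proof -
    obtain T where "T \<ge> w" "g T < r" using small r by auto
    then obtain t where "t \<ge> w" "g t = r" using image[of T r] r by auto
    then show ?thesis using v_g by auto
  qed
  have cont_v: "continuous_on {0<..R} v"
  proof (subst continuous_on_eq_continuous_within, intro ballI)
    fix r assume r: "r \<in> {0<..R}"
    obtain T where T: "T \<ge> w" "g T < r" using small r by auto
    \<comment> \<open>A continuous injection on a compact set has a continuous inverse. Since
      \<open>g T < r\<close>, the interval \<open>{g T..R}\<close> is a neighbourhood of
      \<open>r\<close> relative to \<open>{0<..R}\<close>.\<close>
    have "continuous_on (g ` {w..T}) v"
      using v_g by (intro continuous_on_inv cont_g) auto
    then have "continuous_on {g T..R} v"
      using image T by (elim continuous_on_subset) force
    then have "continuous (at r within {g T..R}) v"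
      using r T by (simp add: continuous_on_eq_continuous_within)
    moreover have "at r within {0<..R} = at r within {g T..R}"
    proof (rule at_within_nhd[where S = "{g T<..}"])
      have "g T > 0"
        using T(1) pos w(1) den[of T] by (simp add: g_def)
      then show "{0<..R} \<inter> {g T<..} - {r} = {g T..R} \<inter> {g T<..} - {r}"
        by auto
    qed (use T in auto)
    ultimately show "continuous (at r within {0<..R}) v"
      by simp
  qed
  \<comment> \<open>Equality would give \<open>r = g w = R\<close>. Strictness keeps
    \<open>g' (v r)\<close> away from zero.\<close>
  have gt: "v r > w" if "r \<in> {0<..<R}" for r
    using v[of r] that gw by (cases "v r = w") auto
  have cv: "continuous_on {0<..<R} v"
    using cont_v by (rule continuous_on_subset) auto
  show ?thesis
  proof
    fix r assume r: "r \<in> {0<..R}"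
    have "(p - 1) * b * w powr p \<le> (p - 1) * b * v r powr p"
      using v[OF r] w(1) p pos by (intro mult_left_mono powr_mono2) auto
    then show "v r > 0 \<and> M \<le> (p - 1) * b * v r powr p \<and> \<beta> * v r = r * (M + b * v r powr p)"
      using v[OF r] w den[of "v r"] by (auto simp: g_def field_simps)
  next
    fix r assume r: "r \<in> {0<..<R}"
    have "isCont v r"
      using cv r by (simp add: continuous_on_eq_continuous_at)
    then have "DERIV v r :> inverse (g' (v r))"
      using r gt[OF r] w(1) v g'_neg[OF gt[OF r]]
      by (intro DERIV_inverse_function[where f = g and a = 0 and b = R] dg) auto
    then show "(v has_real_derivative inverse (g' (v r))) (at r) \<and> inverse (g' (v r)) < 0"
      using g'_neg[OF gt[OF r]] by simp
  next
    have "v r \<noteq> 0" if "r \<in> {0<..<R}" for r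
      using gt[OF that] w(1) by simp
    moreover have "g' (v r) \<noteq> 0" if "r \<in> {0<..<R}" for r
      using g'_neg[OF gt[OF that]] by simp
    moreover have "M + b * v r powr p \<noteq> 0" for r
      using den[of "v r"] by simp
    ultimately show "continuous_on {0<..<R} (\<lambda>r. inverse (g' (v r)))"
      by (intro continuous_intros) (auto simp: g'_def intro!: continuous_intros cv)
  qed (rule cont_v)
qed

section \<open>Construction and properties of the solution\<close>

theorem proposition2:
  fixes p \<beta> b M R :: real and i :: nat
  assumes "p > 1" and "\<beta> > 0" and "b > 0" and "M > 0"
    and "R = crit_radius p \<beta> b M"
    and "1 \<le> i" and "i \<le> CARD('n::finite) - 1"
  shows "\<exists>u :: real \<Rightarrow> ereal.
      u \<in> LSC_radial R \<and>
      C2_on {0<..<R} (\<lambda>r. real_of_ereal (u r)) \<and>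
      solves_eigen_eq i p \<beta> b M (ball 0 R - {0}) (\<lambda>x::real^'n. real_of_ereal (u (norm x))) \<and>
      (\<forall>x \<in> frontier (ball (0::real^'n) R). u (norm x) = 0) \<and>
      (p \<le> 2 \<longrightarrow> (u \<longlongrightarrow> \<infinity>) (at_right 0)) \<and>
      (p > 2 \<longrightarrow> (\<exists>C::real. \<forall>r\<in>{0..R}. \<bar>u r\<bar> \<le> ereal C))"
proof -
  note p = assms(1) and pos = assms(2-4) and i = assms(6,7)
  obtain v v' where
    v: "\<And>r. r \<in> {0<..R} \<Longrightarrow> v r > 0 \<and> M \<le> (p - 1) * b * v r powr p \<and> \<beta> * v r = r * (M + b * v r powr p)"
    and cont_v: "continuous_on {0<..R} v"
    and dv: "\<And>r. r \<in> {0<..<R} \<Longrightarrow> (v has_real_derivative v' r) (at r) \<and> v' r < 0"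
    and cont_v': "continuous_on {0<..<R} v'"
    using upper_branch_exists[OF p pos assms(5)] by blast
  have R: "R > 0"
    using crit_radius_conv[OF p pos] p pos assms(5) by (simp add: add_pos_nonneg)
  define U where "U = (\<lambda>r. integral {r..R} v)"
  \<comment> \<open>Staying on \<open>{a..R}\<close> with \<open>a > 0\<close> avoids the possible
    singularity of \<open>v\<close> at \<open>0\<close>.\<close>
  have dU_within: "(U has_real_derivative - v t) (at t within {a..R})" if "0 < a" "t \<in> {a..R}" for a t
    unfolding U_def
    using that by (intro integral_has_real_derivative' continuous_on_subset[OF cont_v]) auto
  have dU: "(U has_real_derivative - v r) (at r)" if "r \<in> {0<..<R}" for r
    using dU_within[of "r / 2" r] that by (simp add: at_within_Icc_at)
  have cont_U: "continuous_on {a..R} U" if "0 < a" for a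
    using dU_within[OF that] by (rule DERIV_continuous_on)
  have UR: "U R = 0" by (simp add: U_def)
  have anti: "U t \<le> U s" if "0 < s" "s \<le> t" "t \<le> R" for s t
  proof (cases "s = t")
    case False
    then have "s < t" using that by simp
    then have "U t < U s"
    proof (rule DERIV_neg_imp_decreasing_open)
      show "continuous_on {s..t} U"
        using that by (intro continuous_on_subset[OF cont_U[of s]]) auto
    next
      fix x assume "s < x" "x < t"
      then show "\<exists>y. DERIV U x :> y \<and> y < 0"
        using that v[of x] by (intro exI[of _ "- v x"] conjI dU) auto
    qed
    then show ?thesis by simp
  qed simp
  have U0: "0 \<le> U r" if "r \<in> {0<..R}" for r
    using anti[of r R] that UR by simp
  \<comment> \<open>As \<open>U\<close> is decreasing, the supremum is its limit at
    \<open>0\<close>, finite or not, so one definition serves both ranges of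
    \<open>p\<close>.\<close>
  define u where "u = (\<lambda>r. if r = 0 then SUP s\<in>{0<..<R}. ereal (U s) else ereal (U r))"
  have u0: "u 0 \<ge> 0"
  proof -
    have "0 \<le> ereal (U (R / 2))" using U0[of "R / 2"] R by simp
    also have "\<dots> \<le> u 0" unfolding u_def using R by (auto intro!: SUP_upper)
    finally show ?thesis .
  qed

  \<comment> \<open>Lower semicontinuity\<close>
  have "lsc_on {0..R} u"
    unfolding lsc_on_def
  proof
    fix r assume r: "r \<in> {0..R}"
    show "u r \<le> Liminf (at r within {0..R}) u"
    proof (cases "r = 0")
      case True
      \<comment> \<open>Some \<open>U s\<close> exceeds \<open>y\<close>, and monotonicity passes
        this on to all \<open>x\<close> in \<open>{0<..<s}\<close>.\<close>
      have "\<forall>\<^sub>F x in at 0 within {0..R}. y < u x" if y: "y < u 0" for y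
      proof -
        obtain s where s: "s \<in> {0<..<R}" "y < ereal (U s)"
          using y by (auto simp: u_def less_SUP_iff)
        have "\<forall>\<^sub>F x in at 0 within {0..R}. x \<in> {0..R} \<and> x \<noteq> 0 \<and> x < s"
          using s by (auto simp: eventually_at intro!: exI[of _ s])
        then show ?thesis
        proof eventually_elim
          case (elim x)
          then have "ereal (U s) \<le> u x" using s anti[of x s] by (auto simp: u_def)
          with s show ?case by simp
        qed
      qed
      then show ?thesis using True by (simp add: le_Liminf_iff)
    next
      case False
      then have r0: "r > 0" using r by simp
      have ev: "\<forall>\<^sub>F x in at r within {0..R}. x > 0"
        by (rule order_tendstoD(1)[OF tendsto_ident_at r0])
      have "(U \<longlongrightarrow> U r) (at r within {r/2..R})"
        using cont_U[of "r/2"] r r0 by (auto simp: continuous_on)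
      moreover have "at r within {r/2..R} = at r within {0..R}"
        using r0 by (intro at_within_nhd[where S = "{r/2<..}"]) auto
      ultimately have "((\<lambda>x. ereal (U x)) \<longlongrightarrow> u r) (at r within {0..R})"
        using False by (simp add: u_def)
      then have "(u \<longlongrightarrow> u r) (at r within {0..R})"
        by (rule Lim_transform_eventually) (rule eventually_mono[OF ev], simp add: u_def)
      moreover have "at r within {0..R} \<noteq> bot"
        using r R by (simp add: trivial_limit_within islimpt_Icc)
      ultimately show ?thesis
        by (metis lim_imp_Liminf order_refl)
    qed
  qed
  then have lsc: "u \<in> LSC_radial R"
    using u0 by (auto simp: LSC_radial_def u_def)
  have real_u: "real_of_ereal (u r) = U r" if "r \<noteq> 0" for r
    using that by (simp add: u_def)

  \<comment> \<open>Regularity and the equation\<close>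
  have "C2_on {0<..<R} (\<lambda>r. real_of_ereal (u r))"
    unfolding C2_on_def
  proof (rule exI[of _ "\<lambda>r. - v r"], rule exI[of _ "\<lambda>r. - v' r"], intro conjI ballI)
    fix r assume r: "r \<in> {0<..<R}"
    show "((\<lambda>r. real_of_ereal (u r)) has_real_derivative - v r) (at r)"
      by (rule has_field_derivative_transform_within_open[OF dU[OF r], where S = "{0<..<R}"])
        (use r real_u in auto)
    show "((\<lambda>r. - v r) has_real_derivative - v' r) (at r)"
      using dv r by (auto intro: DERIV_minus)
  qed (intro continuous_intros cont_v')
  moreover have "solves_eigen_eq i p \<beta> b M (ball 0 R - {0}) (\<lambda>x::real^'n. real_of_ereal (u (norm x)))"
    unfolding solves_eigen_eq_def
  proof
    fix x :: "real^'n" assume "x \<in> ball 0 R - {0}"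
    then have x: "x \<noteq> 0" "norm x < R" and r: "norm x \<in> {0<..<R}" by auto
    let ?w = "\<lambda>x::real^'n. real_of_ereal (u (norm x))"
    have w: "y \<noteq> 0 \<Longrightarrow> ?w y = U (norm y)" for y
      by (simp add: real_u)
    have dv': "((\<lambda>r. - v r) has_real_derivative - v' (norm x)) (at (norm x))"
      using dv[OF r] by (auto intro: DERIV_minus)
    have vx: "v (norm x) > 0" "\<beta> * v (norm x) = norm x * (M + b * v (norm x) powr p)"
      using v[of "norm x"] r by auto
    \<comment> \<open>The tangential eigenvalue is negative and the radial one positive, because
      \<open>v > 0\<close> and \<open>v' < 0\<close>.\<close>
    have "- v (norm x) / norm x < - v' (norm x)"
      using dv[OF r] vx(1) x(1) by (smt (verit) divide_minus_left divide_nonneg_pos zero_less_norm_iff)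
    note eig = eigenval_hessian_radial[of R U "\<lambda>r. - v r" _ x ?w, OF dU dv' x w this i]
    have "norm (grad ?w x) = v (norm x)"
      using grad_radial_has_derivative(2)[of R U "\<lambda>r. - v r" _ x ?w, OF dU dv' x w] x vx(1)
      by simp
    moreover have "\<beta> * (- v (norm x) / norm x) = - (M + b * v (norm x) powr p)"
      using x(1) vx(2) by simp
    ultimately show "twice_differentiable_at ?w x \<and>
        \<beta> * eigenval i (hessian ?w x) + b * norm (grad ?w x) powr p = - M"
      using eig by simp
  qed
  moreover have "\<forall>x\<in>frontier (ball (0::real^'n) R). u (norm x) = 0"
    using R UR by (auto simp: u_def)

  \<comment> \<open>Blow-up at the origin for \<open>p \<le> 2\<close>\<close>
  moreover have "(u \<longlongrightarrow> \<infinity>) (at_right 0)" if p2: "p \<le> 2"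
  proof -
    \<comment> \<open>On the decreasing branch
      \<open>M + b * v r powr p \<le> p * b * v r powr p\<close>, whence
      \<open>c / r \<le> v r powr (p - 1)\<close>. Taking \<open>r \<le> c\<close> then forces
      \<open>v r \<ge> 1\<close>, so the exponent \<open>p - 1 \<le> 1\<close> may be raised to
      \<open>1\<close>.\<close>
    define c where "c = \<beta> / (p * b)"
    define \<delta> where "\<delta> = min c (R / 2)"
    have c: "c > 0" using p pos by (simp add: c_def)
    have \<delta>: "0 < \<delta>" "\<delta> < R" "\<delta> \<le> c" using c R by (auto simp: \<delta>_def)
    have lower: "c / r \<le> v r" if r: "r \<in> {0<..\<delta>}" for r
    proof -
      have vr: "v r > 0" "M \<le> (p - 1) * b * v r powr p" "\<beta> * v r = r * (M + b * v r powr p)"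
        using v[of r] r \<delta> by auto
      have "r * (M + b * v r powr p) \<le> r * (p * b * v r powr p)"
        using vr r by (intro mult_left_mono) (auto simp: algebra_simps)
      with vr have "\<beta> * v r \<le> r * (p * b * v r powr p)" by simp
      then have "c / r \<le> v r powr (p - 1)"
        using vr(1) r p pos by (simp add: c_def powr_diff field_simps)
      moreover have "1 \<le> c / r" using r \<delta> by simp
      ultimately have "c / r \<le> v r powr (p - 1)" "1 \<le> v r powr (p - 1)" by auto
      moreover from this(2) have "1 \<le> v r"
        using vr(1) p powr_less_mono2[of "p - 1" "v r" 1] by fastforce
      then have "v r powr (p - 1) \<le> v r powr 1"
        using p2 by (intro powr_mono) auto
      ultimately show ?thesis using vr(1) by simp
    qed
    have bound: "c * (ln \<delta> - ln r) \<le> U r" if r: "r \<in> {0<..<\<delta>}" for r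
    proof -
      \<comment> \<open>The bound \<open>c / r \<le> v r\<close> makes \<open>U + c * ln\<close>
        nonincreasing, so \<open>U\<close> grows at least logarithmically at
        \<open>0\<close>.\<close>
      have "U \<delta> + c * ln \<delta> \<le> U r + c * ln r"
      proof (rule DERIV_nonpos_imp_nonincreasing[where f = "\<lambda>x. U x + c * ln x"])
        fix x assume "r \<le> x" "x \<le> \<delta>"
        then have x: "x \<in> {0<..\<delta>}" "x \<in> {0<..<R}" using r \<delta> by auto
        have "((\<lambda>x. U x + c * ln x) has_real_derivative - v x + c * (1 / x)) (at x)"
          using x by (intro DERIV_add dU DERIV_cmult DERIV_ln_divide) auto
        then show "\<exists>y. ((\<lambda>x. U x + c * ln x) has_real_derivative y) (at x) \<and> y \<le> 0"
          using lower[OF x(1)] by force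
      qed (use r in auto)
      then show ?thesis using U0[of \<delta>] \<delta> by (simp add: algebra_simps)
    qed
    have "filterlim (\<lambda>r. c * (ln \<delta> + - ln r)) at_top (at_right 0)"
      by (intro filterlim_tendsto_pos_mult_at_top[OF tendsto_const c]
          filterlim_tendsto_add_at_top[OF tendsto_const]
          filterlim_compose[OF filterlim_uminus_at_top_at_bot ln_at_0])
    then have "filterlim U at_top (at_right 0)"
      by (rule filterlim_at_top_mono)
        (use bound \<delta> in \<open>auto simp: eventually_at_right_field intro!: exI[of _ \<delta>]\<close>)
    then have "((\<lambda>r. ereal (U r)) \<longlongrightarrow> \<infinity>) (at_right 0)"
      by (simp add: tendsto_PInfty_eq_at_top)
    then show ?thesis
      by (rule Lim_transform_eventually) (auto simp: u_def eventually_at_filter)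
  qed

  \<comment> \<open>Boundedness for \<open>p > 2\<close>\<close>
  moreover have "\<exists>C::real. \<forall>r\<in>{0..R}. \<bar>u r\<bar> \<le> ereal C" if p2: "p > 2"
  proof -
    \<comment> \<open>Dropping \<open>M\<close> from the equation for \<open>v\<close> gives
      \<open>v r \<le> K * r powr (- 1 / (p - 1))\<close>. The exponent is \<open>a - 1\<close>, and
      \<open>a > 0\<close> makes this bound integrable at \<open>0\<close>.\<close>
    define a where "a = 1 - 1 / (p - 1)"
    define K where "K = (\<beta> / b) powr (1 / (p - 1))"
    have a: "a > 0" using p2 by (simp add: a_def)
    have K: "K > 0" using pos by (simp add: K_def)
    have upper: "v r \<le> K * r powr (a - 1)" if r: "r \<in> {0<..R}" for r
    proof -
      have vr: "v r > 0" "\<beta> * v r = r * (M + b * v r powr p)"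
        using v[of r] r by auto
      have "r * (b * v r powr p) \<le> \<beta> * v r"
        using vr r pos by simp
      then have "v r powr (p - 1) \<le> \<beta> / b / r"
        using vr(1) r pos by (simp add: powr_diff field_simps)
      then have "(v r powr (p - 1)) powr (1 / (p - 1)) \<le> (\<beta> / b / r) powr (1 / (p - 1))"
        using p by (intro powr_mono2) auto
      also have "(v r powr (p - 1)) powr (1 / (p - 1)) = v r"
        using p vr(1) by (simp add: powr_powr)
      also have "(\<beta> / b / r) powr (1 / (p - 1)) = K * r powr (a - 1)"
        using r pos by (simp add: K_def a_def powr_divide powr_mult powr_minus_divide)
      finally show ?thesis .
    qed
    \<comment> \<open>This is the integral of \<open>K * r powr (a - 1)\<close> over
      \<open>{0..R}\<close>.\<close>
    define C where "C = K / a * R powr a"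
    have bound: "U r \<le> C" if r: "r \<in> {0<..R}" for r
    proof -
      have "U r + K / a * r powr a \<le> U R + K / a * R powr a"
      proof (rule DERIV_nonneg_imp_increasing_open[where f = "\<lambda>x. U x + K / a * x powr a"])
        fix x assume "r < x" "x < R"
        then have x: "x \<in> {0<..<R}" using r by auto
        have "((\<lambda>x. U x + K / a * x powr a) has_real_derivative
            - v x + K / a * (a * x powr (a - 1))) (at x)"
          using x by (intro DERIV_add dU DERIV_cmult has_real_derivative_powr) auto
        then show "\<exists>y. ((\<lambda>x. U x + K / a * x powr a) has_real_derivative y) (at x) \<and> 0 \<le> y"
          using upper[of x] x a by (intro exI conjI) auto
      qed (use r a cont_U[of r] in \<open>auto intro!: continuous_intros\<close>)
      moreover have "0 \<le> K / a * r powr a" using K a by simp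
      ultimately show ?thesis using UR by (simp add: C_def)
    qed
    have "u 0 \<le> ereal C"
      unfolding u_def using bound by (auto intro!: SUP_least)
    then have "\<bar>u r\<bar> \<le> ereal C" if "r \<in> {0..R}" for r
      using that u0 U0[of r] bound[of r] by (cases "r = 0") (auto simp: u_def)
    then show ?thesis by blast
  qed
  ultimately show ?thesis using lsc by blast
qed

end
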